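(* Let $n\in\mathbb N_0$ and $b,c,d,e,f,q\in\mathbb C^*$ with $|q|\ne1$. Then (whenever no denominator occurring vanishes) $${}_8W_7\left(\frac{qb^2}{def};q^{-n},\frac{qb}{de},\frac{qb}{df},\frac{qb}{ef},c;q,\frac{q^{n+1}b}c\right)$$ $$=\frac{\left(\frac{qb}c,\frac{q^2b^2}{def};q\right)_n}{\left(\frac{qb}d,\frac{q^2b^2}{cef};q\right)_n}\,{}_8W_7\left(\frac{qb^2}{cef};q^{-n},\frac{qb}{ce},\frac{qb}{cf},\frac{qb}{ef},d;q,\frac{q^{n+1}b}d\right)$$ $$=\frac{\left(\frac{qb}c,\frac{q^2b^2}{def};q\right)_n}{\left(\frac{qb}e,\frac{q^2b^2}{cdf};q\right)_n}\,{}_8W_7\left(\frac{qb^2}{cdf};q^{-n},\frac{qb}{cd},\frac{qb}{cf},\frac{qb}{df},e;q,\frac{q^{n+1}b}e\right)$$ $$=\frac{\left(\frac{qb}c,\frac{q^2b^2}{def};q\right)_n}{\left(\frac{qb}f,\frac{q^2b^2}{cde};q\right)_n}\,{}_8W_7\left(\frac{qb^2}{cde};q^{-n},\frac{qb}{cd},\frac{qb}{ce},\frac{qb}{de},f;q,\frac{q^{n+1}b}f\right).$$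
   Context: $\mathbb N_0=\{0,1,2,\ldots\}$, $\mathbb C^*=\mathbb C\setminus\{0\}$; $e$ is a parameter, not Euler's number. The $q$-Pochhammer symbol is $(a;q)_n=(1-a)(1-aq)\cdots(1-aq^{n-1})$ (empty product equal to $1$), and $(a_1,\ldots,a_k;q)_n=(a_1;q)_n\cdots(a_k;q)_n$. The terminating very-well poised series is $${}_8W_7(b;q^{-n},c,d,e,f;q,z)=\sum_{k=0}^n\frac{\left(b,q\sqrt b,-q\sqrt b,q^{-n},c,d,e,f;q\right)_k}{\left(q,\sqrt b,-\sqrt b,q^{n+1}b,\frac{qb}c,\frac{qb}d,\frac{qb}e,\frac{qb}f;q\right)_k}z^k,$$ where $\sqrt b$ is either square root of $b$. Standing convention: denominator parameters of a terminating series avoid $\{q^{-k}:0\le k\le n-1\}$, so that no denominator vanishes. *)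

theory Defs
  imports Complex_Main
begin

definition qpoch :: "complex \<Rightarrow> complex \<Rightarrow> nat \<Rightarrow> complex" where
  "qpoch a q n = (\<Prod>j<n. 1 - a * q ^ j)"

definition qpochs :: "complex list \<Rightarrow> complex \<Rightarrow> nat \<Rightarrow> complex" where
  "qpochs as q n = (\<Prod>a\<leftarrow>as. qpoch a q n)"

definition W87_num ::
  "nat \<Rightarrow> complex \<Rightarrow> complex \<Rightarrow> complex \<Rightarrow> complex \<Rightarrow> complex \<Rightarrow> complex \<Rightarrow> complex list" where
  "W87_num n b c d e f q =
     [b, q * csqrt b, - q * csqrt b, q powi (- int n), c, d, e, f]"

definition W87_den ::
  "nat \<Rightarrow> complex \<Rightarrow> complex \<Rightarrow> complex \<Rightarrow> complex \<Rightarrow> complex \<Rightarrow> complex \<Rightarrow> complex list" where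
  "W87_den n b c d e f q =
     [q, csqrt b, - csqrt b, q ^ (n + 1) * b, q * b / c, q * b / d, q * b / e, q * b / f]"

text \<open>\<open>W87 n b c d e f q z\<close> is the series usually written
  \<open>8W7(b; q^(-n), c, d, e, f; q, z)\<close>. The choice of square root is immaterial, see
  \<open>W87_any_sqrt\<close> and \<open>W87_wf_any_sqrt\<close>.\<close>

definition W87 ::
  "nat \<Rightarrow> complex \<Rightarrow> complex \<Rightarrow> complex \<Rightarrow> complex \<Rightarrow> complex \<Rightarrow> complex \<Rightarrow> complex \<Rightarrow> complex" where
  "W87 n b c d e f q z =
     (\<Sum>k\<le>n. qpochs (W87_num n b c d e f q) q k / qpochs (W87_den n b c d e f q) q k * z ^ k)"

text \<open>The convention that the denominator parameters of a terminating series avoid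
  \<open>q^(-k)\<close> for \<open>0 \<le> k \<le> n - 1\<close>; for \<open>q \<noteq> 0\<close> it says that no denominator vanishes
  (\<open>W87_wf_iff\<close>).\<close>

definition W87_wf ::
  "nat \<Rightarrow> complex \<Rightarrow> complex \<Rightarrow> complex \<Rightarrow> complex \<Rightarrow> complex \<Rightarrow> complex \<Rightarrow> bool" where
  "W87_wf n b c d e f q \<longleftrightarrow>
     (\<forall>a \<in> set (W87_den n b c d e f q). \<forall>k<n. a \<noteq> q powi (- int k))"

lemma qpoch_eq_0_iff:
  assumes "q \<noteq> 0"
  shows "qpoch a q n = 0 \<longleftrightarrow> (\<exists>k<n. a = q powi (- int k))"
proof -
  have "1 - a * q ^ k = 0 \<longleftrightarrow> a = q powi (- int k)" for k
    using assms by (auto simp: power_int_minus field_simps)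
  then show ?thesis
    by (auto simp: qpoch_def)
qed

lemma W87_wf_iff:
  assumes "q \<noteq> 0"
  shows "W87_wf n b c d e f q \<longleftrightarrow> (\<forall>k\<le>n. qpochs (W87_den n b c d e f q) q k \<noteq> 0)"
proof -
  have "qpochs as q k \<noteq> 0 \<longleftrightarrow> (\<forall>a\<in>set as. qpoch a q k \<noteq> 0)" for as k
    by (induction as) (auto simp: qpochs_def)
  then have "qpochs as q k \<noteq> 0 \<longleftrightarrow> (\<forall>a\<in>set as. \<forall>j<k. a \<noteq> q powi (- int j))" for as k
    using assms by (metis qpoch_eq_0_iff)
  then show ?thesis
    unfolding W87_wf_def by (metis dual_order.strict_trans1 order_refl)
qed

lemma W87_any_sqrt:
  assumes "s\<^sup>2 = b"
  shows "W87 n b c d e f q z =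
    (\<Sum>k\<le>n. qpochs [b, q * s, - q * s, q powi (- int n), c, d, e, f] q k /
       qpochs [q, s, - s, q ^ (n + 1) * b, q * b / c, q * b / d, q * b / e, q * b / f] q k * z ^ k)"
proof -
  have "s = csqrt b \<or> s = - csqrt b"
    using assms by (metis power2_csqrt power2_eq_iff)
  then show ?thesis
    by (auto simp: W87_def W87_num_def W87_den_def qpochs_def mult_ac)
qed

lemma W87_wf_any_sqrt:
  assumes "s\<^sup>2 = b"
  shows "W87_wf n b c d e f q \<longleftrightarrow>
    (\<forall>a \<in> set [q, s, - s, q ^ (n + 1) * b, q * b / c, q * b / d, q * b / e, q * b / f].
       \<forall>k<n. a \<noteq> q powi (- int k))"
proof -
  have "s = csqrt b \<or> s = - csqrt b"
    using assms by (metis power2_csqrt power2_eq_iff)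
  then show ?thesis
    by (auto simp: W87_wf_def W87_den_def)
qed

end

theory Submission
  imports Defs
begin

text \<open>
  The idea is a hidden symmetry. Watson's transformation

  \<open>8W7(a; q\<^sup>-\<^sup>n, b, c, d, e) =
     (aq, aq/(de); q)\<^sub>n / (aq/d, aq/e; q)\<^sub>n \<cdot> 4phi3(q\<^sup>-\<^sup>n, aq/(bc), d, e; aq/b, aq/c, deq\<^sup>-\<^sup>n/a; q, q)\<close>

  turns the very-well-poised series with \<open>a = qb\<^sup>2/(def)\<close> and parameters
  \<open>qb/(de)\<close>, \<open>qb/(df)\<close>, \<open>qb/(ef)\<close>, \<open>c\<close> into a balanced series with numerator parameters
  \<open>q\<^sup>-\<^sup>n\<close>, \<open>c\<close>, \<open>d\<close>, \<open>qb/(ef)\<close> and denominator parameters \<open>qb/e\<close>, \<open>qb/f\<close>, \<open>cdq\<^sup>-\<^sup>n/b\<close>.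
  This balanced series does not change when \<open>c\<close> and \<open>d\<close> are exchanged, so the two
  very-well-poised series in which \<open>c\<close> and \<open>d\<close> have changed places differ only by the
  prefactors (\<open>W87_exchange\<close>). The left-hand side is symmetric in \<open>d\<close>, \<open>e\<close>, \<open>f\<close>, so \<open>c\<close> may
  equally be exchanged with \<open>e\<close> or with \<open>f\<close>.

  Watson's transformation (\<open>watson_transformation\<close>) comes from Bailey's lemma
  (\<open>bailey_lemma\<close>), whose proof is an interchange of summations and the q-Pfaff--Saalschuetz
  sum (\<open>saal_sum\<close>). Applied twice to the unit Bailey pair (\<open>bailey_pair_unit\<close>), it gives the
  transformation for generic \<open>a\<close>, where \<open>(aq;q)\<^bsub>2n\<^esub> \<noteq> 0\<close>. In a series whose denominators do not vanish,
  \<open>aq\<^sup>j = 1\<close> is still possible for some \<open>1 \<le> j \<le> n\<close>; such \<open>a\<close> are isolated, and both sides are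
  continuous there, so they are reached by a limit (\<open>watson_vwp\<close>). The transformation is kept
  in a form cleared of denominators, which has a meaning even where
  \<open>(aq/(de);q)\<^sub>n = 0\<close> and the \<open>4phi3\<close> itself does not.
\<close>

section \<open>Shifted factorials\<close>

lemma qpoch_0 [simp]: "qpoch a q 0 = 1"
  by (simp add: qpoch_def)

lemma qpoch_Suc: "qpoch a q (Suc n) = qpoch a q n * (1 - a * q ^ n)"
  by (simp add: qpoch_def)

lemma qpoch_add: "qpoch a q (m + n) = qpoch a q m * qpoch (a * q ^ m) q n"
  by (induction n) (auto simp: qpoch_Suc power_add mult_ac)

lemma qpoch_Suc_left: "qpoch a q (Suc n) = (1 - a) * qpoch (a * q) q n"
  using qpoch_add[of a q 1 n] by (simp add: qpoch_Suc)

lemma qpoch_nonzero_mono: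
  assumes "qpoch a q n \<noteq> 0" "m \<le> n"
  shows "qpoch a q m \<noteq> 0"
  using assms qpoch_add[of a q m "n - m"] by auto

lemma power_neq_1_of_norm:
  fixes q :: complex
  assumes "cmod q \<noteq> 1" "0 < k"
  shows "q ^ k \<noteq> 1"
proof
  assume "q ^ k = 1"
  then have "cmod q ^ k = 1"
    by (metis norm_one norm_power)
  then show False
    using assms power_eq_imp_eq_base[of "cmod q" k 1] by auto
qed

lemma qpoch_q_nonzero:
  assumes "cmod q \<noteq> 1"
  shows "qpoch q q n \<noteq> 0"
proof (induction n)
  case (Suc n)
  have "q ^ Suc n \<noteq> 1"
    using power_neq_1_of_norm[OF assms] by blast
  with Suc show ?case
    by (simp add: qpoch_Suc)
qed simp

text \<open>The reversal rule that turns \<open>(q\<^sup>-\<^sup>n;q)\<^sub>k\<close> into \<open>1/(q;q)\<^bsub>n-k\<^esub>\<close>, the form in which the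
  upper bound of a terminating series appears in a Bailey pair.\<close>

lemma qpoch_q_power_minus:
  assumes "q \<noteq> 0" "k \<le> n"
  shows "qpoch (q powi (- int n)) q k * q ^ (n * k) * qpoch q q (n - k) =
           (- 1) ^ k * q ^ (k choose 2) * qpoch q q n"
  using assms(2)
proof (induction k)
  case (Suc k)
  then obtain i where n: "n = Suc k + i"
    using le_Suc_ex by blast
  have qn: "q ^ n = q ^ k * (q * q ^ i)"
    by (simp add: n power_add)
  have inv: "q powi (- int n) * q ^ n = 1"
    using assms(1) by (simp add: power_int_minus)
  have "(1 - q powi (- int n) * q ^ k) * q ^ n = - (q ^ k) * (1 - q ^ Suc i)"
    using inv by (simp add: qn algebra_simps)
  moreover have "qpoch q q (n - k) = qpoch q q (n - Suc k) * (1 - q ^ Suc i)"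
    by (simp add: n qpoch_Suc)
  then have "qpoch (q powi (- int n)) q k * q ^ (n * k) * (qpoch q q (n - Suc k) * (1 - q ^ Suc i))
      = (- 1) ^ k * q ^ (k choose 2) * qpoch q q n"
    using Suc by simp
  moreover have "x * w = - y * z \<Longrightarrow> P * X * (R * z) = S * B * D \<Longrightarrow>
      P * x * (X * w) * R = - (S * (y * B) * D)" for x w y z P X R S B D :: complex
    by algebra
  ultimately have "qpoch (q powi (- int n)) q k * (1 - q powi (- int n) * q ^ k) *
      (q ^ (n * k) * q ^ n) * qpoch q q (n - Suc k)
      = - ((- 1) ^ k * (q ^ k * q ^ (k choose 2)) * qpoch q q n)"
    by blast
  moreover have "q ^ (Suc k choose 2) = q ^ k * q ^ (k choose 2)"
    by (simp add: numeral_2_eq_2 power_add)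
  moreover have "q ^ (n * Suc k) = q ^ (n * k) * q ^ n"
    by (simp add: power_add)
  ultimately show ?case
    by (simp add: qpoch_Suc)
qed (simp add: numeral_2_eq_2)

section \<open>The q-Pfaff--Saalschuetz sum\<close>

text \<open>The third denominator parameter \<open>C = ABx\<close> of the balanced series is traded for \<open>x\<close>.
  Multiplied by \<open>(C;q)\<^sub>n (x;q)\<^sub>n / (q;q)\<^sub>n\<close>, the term of
  \<open>3phi2(q\<^sup>-\<^sup>n, A, B; C, q\<^bsup>1-n\<^esup>/x; q, q)\<close> becomes a polynomial in \<open>A\<close>, \<open>B\<close> and \<open>x\<close>, and
  the summation formula a polynomial identity.\<close>

definition saal_term where
  "saal_term A B x q n k =
     qpoch A q k * qpoch B q k * qpoch (A * B * x * q ^ k) q (n - k) * qpoch x q (n - k) * x ^ k /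
     (qpoch q q k * qpoch q q (n - k))"

text \<open>The step of \<open>saal_partial_sum\<close> from index \<open>k\<close> to \<open>k + 1\<close> after division by the common
  factor, with \<open>K = q\<^sup>k\<close>, \<open>M = q\<^bsup>n-k-1\<^esup>\<close>, and \<open>qKM\<close> in the place of \<open>q\<^sup>n\<close>.\<close>

lemma saal_certificate:
  fixes A B x q K M :: complex
  shows "(1 - q * (q * K * M)) * ((1 - A * B * x * (q * K * M)) * (1 - x * M))
         - (1 - A * x * (q * K * M)) * (1 - B * x * (q * K * M)) * (1 - q * M)
       = q * M * ((1 - A * B * x * K) * (1 - x * M) * (1 - q * K))
         - M * (1 - A * (q * K)) * (1 - B * (q * K)) * x * (1 - q * M)"
  by algebra

text \<open>The product formula satisfies a first-order recurrence in \<open>n\<close>. The summand on the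
  left is the defect of the single terms in this recurrence, and it telescopes. The certificate, found by comparing both
  sides at \<open>q\<^sup>k = 1\<close> and \<open>q\<^sup>k = q\<^bsup>n+1\<^esup>\<close>, is a multiple of the term itself. The sum stops at
  \<open>m \<le> n\<close>, so that the certificate involves no truncated exponent.\<close>

lemma saal_partial_sum:
  assumes "cmod q \<noteq> 1" "m \<le> n"
  shows "(\<Sum>k\<le>m. (1 - q ^ Suc n) * saal_term A B x q (Suc n) k
                  - (1 - A * x * q ^ n) * (1 - B * x * q ^ n) * saal_term A B x q n k)
       = - (q ^ (n - m) * (1 - A * q ^ m) * (1 - B * q ^ m) * x * saal_term A B x q n m)"
  using assms(2)
proof (induction m)
  case 0
  have nz: "qpoch q q n \<noteq> 0" "1 - q * q ^ n \<noteq> 0"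
    using qpoch_q_nonzero[OF assms(1)] power_neq_1_of_norm[OF assms(1), of "Suc n"] by auto
  define C where "C = qpoch (A * B * x) q n * qpoch x q n / qpoch q q n"
  have T: "saal_term A B x q n 0 = C"
    "(1 - q ^ Suc n) * saal_term A B x q (Suc n) 0 =
       C * ((1 - A * B * x * q ^ n) * (1 - x * q ^ n))"
    using nz by (simp_all add: saal_term_def qpoch_Suc C_def)
  show ?case
    by (simp add: T(1) T(2)[simplified]) algebra
next
  case (Suc k)
  then obtain i where n: "n = Suc k + i"
    using le_Suc_ex by blast
  define K M where "K = q ^ k" and "M = q ^ i"
  have N: "q ^ n = q * K * M"
    by (simp add: n K_def M_def power_add)
  have nz: "qpoch q q k \<noteq> 0" "qpoch q q i \<noteq> 0" "1 - q * K \<noteq> 0" "1 - q * M \<noteq> 0"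
    using qpoch_q_nonzero[OF assms(1)] power_neq_1_of_norm[OF assms(1), of "Suc k"]
      power_neq_1_of_norm[OF assms(1), of "Suc i"] by (auto simp: K_def M_def)
  \<comment> \<open>The common factor of the terms at \<open>k\<close> and \<open>k + 1\<close>; dividing by it leaves \<open>saal_certificate\<close>.\<close>
  define C where "C = qpoch A q k * (1 - A * K) * qpoch B q k * (1 - B * K) *
      qpoch (A * B * x * (q * K)) q i * qpoch x q i * x ^ Suc k /
      (qpoch q q k * qpoch q q i * (1 - q * K) * (1 - q * M))"
  have d: "Suc n - Suc k = Suc i" "n - Suc k = i" "n - k = Suc i"
    by (auto simp: n)
  have T1: "saal_term A B x q (Suc n) (Suc k) =
      C * ((1 - A * B * x * (q * K * M)) * (1 - x * M))"
    unfolding saal_term_def d C_def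
    by (simp add: qpoch_Suc K_def M_def mult_ac)
  have T2: "saal_term A B x q n (Suc k) = C * (1 - q * M)"
    unfolding saal_term_def d C_def using nz
    by (simp add: qpoch_Suc) (simp add: K_def M_def mult_ac)
  have T3: "(1 - A * K) * (1 - B * K) * x * saal_term A B x q n k =
      C * ((1 - A * B * x * K) * (1 - x * M) * (1 - q * K))"
    unfolding saal_term_def d C_def qpoch_Suc_left[of "A * B * x * q ^ k"] using nz
    by (simp add: qpoch_Suc) (simp add: K_def M_def mult_ac)
  have IH: "(\<Sum>j\<le>k. (1 - q ^ Suc n) * saal_term A B x q (Suc n) j
                  - (1 - A * x * q ^ n) * (1 - B * x * q ^ n) * saal_term A B x q n j)
     = - (q * M * ((1 - A * K) * (1 - B * K) * x * saal_term A B x q n k))"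
    using Suc d by (simp add: K_def M_def mult_ac)
  have factor: "v * w - y * t = q * M * u - g * t \<Longrightarrow>
      - (q * M * (C * u)) + (v * (C * w) - y * (C * t)) = - (g * (C * t))" for g t u v w y
    by algebra
  have qs: "q ^ Suc n = q * (q * K * M)" "q ^ Suc k = q * K" "q ^ (n - Suc k) = M"
    by (simp_all add: N K_def M_def d)
  show ?case
    unfolding sum.atMost_Suc IH T3 unfolding T1 T2 qs N
    by (rule factor) (rule saal_certificate)
qed

text \<open>At \<open>m = n\<close> the telescoped remainder is exactly cancelled by the one further term
  \<open>k = n + 1\<close>, which only the sum for \<open>n + 1\<close> has; this leaves the recurrence of the
  product side.\<close>

lemma saal_sum:
  assumes "cmod q \<noteq> 1"
  shows "(\<Sum>k\<le>n. saal_term A B x q n k) = qpoch (A * x) q n * qpoch (B * x) q n / qpoch q q n"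
proof (induction n)
  case 0
  show ?case by (simp add: saal_term_def)
next
  case (Suc n)
  have nz: "qpoch q q n \<noteq> 0" "1 - q ^ Suc n \<noteq> 0"
    using qpoch_q_nonzero[OF assms] power_neq_1_of_norm[OF assms, of "Suc n"] by auto
  have top: "(1 - q ^ Suc n) * saal_term A B x q (Suc n) (Suc n) =
      (1 - A * q ^ n) * (1 - B * q ^ n) * x * saal_term A B x q n n"
    using nz by (simp add: saal_term_def qpoch_Suc)
  have "(1 - q ^ Suc n) * (\<Sum>k\<le>n. saal_term A B x q (Suc n) k)
      - (1 - A * x * q ^ n) * (1 - B * x * q ^ n) * (\<Sum>k\<le>n. saal_term A B x q n k)
      = - ((1 - A * q ^ n) * (1 - B * q ^ n) * x * saal_term A B x q n n)"
    using saal_partial_sum[OF assms, of n n A B x]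
    by (simp add: sum_subtractf sum_distrib_left)
  moreover have "x - y = - z \<Longrightarrow> x + z = y" for x y z :: complex
    by (simp add: algebra_simps)
  ultimately have "(1 - q ^ Suc n) * (\<Sum>k\<le>Suc n. saal_term A B x q (Suc n) k) =
      (1 - A * x * q ^ n) * (1 - B * x * q ^ n) * (\<Sum>k\<le>n. saal_term A B x q n k)"
    unfolding sum.atMost_Suc distrib_left top by blast
  with Suc nz show ?case
    by (simp add: qpoch_Suc divide_simps) (simp add: mult_ac)
qed

section \<open>Bailey pairs\<close>

text \<open>The range of \<open>n\<close> is bounded by \<open>N\<close> because the relation is of use only where
  \<open>(aq;q)\<^bsub>2N\<^esub> \<noteq> 0\<close>, which is then a condition on finitely many values of \<open>a\<close>.\<close>

definition bailey_pair :: "nat \<Rightarrow> complex \<Rightarrow> complex \<Rightarrow> (nat \<Rightarrow> complex) \<Rightarrow> (nat \<Rightarrow> complex) \<Rightarrow> bool" where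
  "bailey_pair N a q \<alpha> \<beta> \<longleftrightarrow>
     (\<forall>n\<le>N. \<beta> n = (\<Sum>r\<le>n. \<alpha> r / (qpoch q q (n - r) * qpoch (a * q) q (n + r))))"

definition unit_alpha where
  "unit_alpha a q r =
     qpoch a q r * (1 - a * q ^ (2 * r)) / (1 - a) * (- 1) ^ r * q ^ (r choose 2) / qpoch q q r"

text \<open>The partial sums have a closed product form with the factor \<open>1 - q\<^bsup>n-m\<^esup>\<close>, so the complete
  sum vanishes for \<open>n > 0\<close>. Multiplying by \<open>1 - q\<^sup>n\<close> lets the same formula hold for \<open>n = 0\<close>.\<close>

lemma unit_alpha_partial_sum:
  assumes "cmod q \<noteq> 1" "a \<noteq> 1" "qpoch (a * q) q (2 * n) \<noteq> 0" "m \<le> n"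
  shows "(1 - q ^ n) * (\<Sum>r\<le>m. unit_alpha a q r / (qpoch q q (n - r) * qpoch (a * q) q (n + r)))
     = (- 1) ^ m * q ^ (Suc m choose 2) * qpoch (a * q) q m * (1 - q ^ (n - m)) /
         (qpoch q q m * qpoch q q (n - m) * qpoch (a * q) q (n + m))"
  using assms(4)
proof (induction m)
  case 0
  then show ?case
    using assms(2) by (simp add: unit_alpha_def numeral_2_eq_2)
next
  case (Suc k)
  then obtain i where n: "n = Suc k + i"
    using le_Suc_ex by blast
  define K M where "K = q ^ k" and "M = q ^ i"
  have d: "n - Suc k = i" "n - k = Suc i" "n + Suc k = Suc (n + k)"
    by (auto simp: n)
  have ch: "Suc (Suc k) choose 2 = Suc k + (Suc k choose 2)"
    by (simp add: numeral_2_eq_2)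
  have pw: "q ^ n = q * K * M" "q ^ (n + k) = q * K * K * M" "q ^ Suc k = q * K" "q ^ i = M"
    "q ^ Suc i = q * M" "q ^ (2 * Suc k) = q * q * K * K"
    by (simp_all add: n K_def M_def power_add power_mult power2_eq_square mult_ac)
  have nz: "qpoch q q k \<noteq> 0" "qpoch q q i \<noteq> 0" "1 - q * K \<noteq> 0" "1 - q * M \<noteq> 0" "1 - a \<noteq> 0"
    using qpoch_q_nonzero[OF assms(1)] power_neq_1_of_norm[OF assms(1), of "Suc k"]
      power_neq_1_of_norm[OF assms(1), of "Suc i"] assms(2) by (auto simp: K_def M_def)
  have nz2: "qpoch (a * q) q (Suc (n + k)) \<noteq> 0"
    using assms(3) by (rule qpoch_nonzero_mono) (simp add: n)
  then have nz3: "qpoch (a * q) q (n + k) \<noteq> 0" "1 - a * q * (q * K * K * M) \<noteq> 0"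
    by (auto simp: qpoch_Suc pw)
  define C where "C = (- 1) ^ k * q ^ (Suc k choose 2) * qpoch (a * q) q k /
     (qpoch q q k * (1 - q * K) * qpoch q q i * (1 - q * M) *
      (qpoch (a * q) q (n + k) * (1 - a * q * (q * K * K * M))))"
  have T1: "unit_alpha a q (Suc k) / (qpoch q q i * qpoch (a * q) q (Suc (n + k)))
      = - (C * (1 - a * (q * q * K * K)) * (1 - q * M))"
    unfolding unit_alpha_def qpoch_Suc_left[of a] C_def qpoch_Suc[of q] qpoch_Suc[of _ _ "n + k"] pw
    using nz nz3 by (simp add: K_def[symmetric]) (simp add: mult_ac)
  have T2: "(- 1) ^ k * q ^ (Suc k choose 2) * qpoch (a * q) q k * (1 - q * M) /
         (qpoch q q k * (qpoch q q i * (1 - q * M)) * qpoch (a * q) q (n + k))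
      = C * (1 - q * K) * (1 - q * M) * (1 - a * q * (q * K * K * M))"
    unfolding C_def using nz nz3 by simp
  have T3: "(- 1) ^ Suc k * (q ^ Suc k * q ^ (Suc k choose 2)) * (qpoch (a * q) q k * (1 - a * q * K)) * (1 - M) /
         (qpoch q q k * (1 - q * K) * qpoch q q i * (qpoch (a * q) q (n + k) * (1 - a * q * (q * K * K * M))))
      = - (C * (q * K) * (1 - a * q * K) * (1 - M) * (1 - q * M))"
    unfolding C_def using nz nz3 by (simp add: K_def) (simp add: mult_ac)
  have IH: "(1 - q ^ n) * (\<Sum>r\<le>k. unit_alpha a q r / (qpoch q q (n - r) * qpoch (a * q) q (n + r)))
     = C * (1 - q * K) * (1 - q * M) * (1 - a * q * (q * K * K * M))"
    using Suc n d T2 by (simp add: qpoch_Suc M_def)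
  have rhs: "(- 1) ^ Suc k * q ^ (Suc (Suc k) choose 2) * qpoch (a * q) q (Suc k) * (1 - q ^ i) /
         (qpoch q q (Suc k) * qpoch q q i * qpoch (a * q) q (Suc (n + k))) =
         - (C * (q * K) * (1 - a * q * K) * (1 - M) * (1 - q * M))"
    unfolding T3[symmetric] ch power_add[of q "Suc k"] qpoch_Suc pw
    by (simp add: K_def M_def)
  show ?case
    unfolding sum.atMost_Suc distrib_left IH d T1
    unfolding rhs unfolding pw
    by (simp add: algebra_simps)
qed

lemma bailey_pair_unit:
  assumes "cmod q \<noteq> 1" "a \<noteq> 1" "qpoch (a * q) q (2 * N) \<noteq> 0"
  shows "bailey_pair N a q (unit_alpha a q) (\<lambda>n. if n = 0 then 1 else 0)"
  unfolding bailey_pair_def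
proof (intro allI impI)
  fix n assume "n \<le> N"
  then have "qpoch (a * q) q (2 * n) \<noteq> 0"
    by (intro qpoch_nonzero_mono[OF assms(3)]) simp
  from unit_alpha_partial_sum[OF assms(1,2) this, of n]
  have "(1 - q ^ n) * (\<Sum>r\<le>n. unit_alpha a q r / (qpoch q q (n - r) * qpoch (a * q) q (n + r))) = 0"
    by simp
  then show "(if n = 0 then 1 else 0) =
      (\<Sum>r\<le>n. unit_alpha a q r / (qpoch q q (n - r) * qpoch (a * q) q (n + r)))"
    using power_neq_1_of_norm[OF assms(1), of n] assms(2)
    by (cases "n = 0") (auto simp: unit_alpha_def numeral_2_eq_2)
qed

text \<open>Inserting the defining sum of \<open>\<beta>\<close> and exchanging the summations, the coefficient of \<open>\<alpha> r\<close>
  is a sum over \<open>j = r, \<dots>, n\<close>. Shifted to start at \<open>0\<close>, it is the Saalschuetz sum with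
  \<open>A = \<rho> q\<^sup>r\<close>, \<open>B = \<sigma> q\<^sup>r\<close>, \<open>x = aq/(\<rho>\<sigma>)\<close> and length \<open>n - r\<close>, for which
  \<open>ABx = aq\<^bsup>2r+1\<^esup>\<close> supplies the factor \<open>(aq;q)\<^bsub>n+r\<^esub>\<close> of the new pair.\<close>

lemma bailey_lemma:
  assumes q: "cmod q \<noteq> 1" and pair: "bailey_pair N a q \<alpha> \<beta>"
    and nz: "\<rho> \<noteq> 0" "\<sigma> \<noteq> 0" "qpoch (a * q) q (2 * N) \<noteq> 0"
      "qpoch (a * q / \<rho>) q N \<noteq> 0" "qpoch (a * q / \<sigma>) q N \<noteq> 0"
  defines "y \<equiv> a * q / (\<rho> * \<sigma>)"
  shows "bailey_pair N a q
     (\<lambda>r. qpoch \<rho> q r * qpoch \<sigma> q r * y ^ r / (qpoch (a * q / \<rho>) q r * qpoch (a * q / \<sigma>) q r) * \<alpha> r)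
     (\<lambda>n. (\<Sum>j\<le>n. qpoch \<rho> q j * qpoch \<sigma> q j * qpoch y q (n - j) * y ^ j / qpoch q q (n - j) * \<beta> j) /
        (qpoch (a * q / \<rho>) q n * qpoch (a * q / \<sigma>) q n))"
  unfolding bailey_pair_def
proof (intro allI impI)
  fix n assume n: "n \<le> N"
  define w where "w j = qpoch \<rho> q j * qpoch \<sigma> q j * qpoch y q (n - j) * y ^ j / qpoch q q (n - j)" for j
  define D where "D = qpoch (a * q / \<rho>) q n * qpoch (a * q / \<sigma>) q n"
  have inner: "(\<Sum>j\<in>{r..n}. w j / (qpoch q q (j - r) * qpoch (a * q) q (j + r))) / D =
      qpoch \<rho> q r * qpoch \<sigma> q r * y ^ r / (qpoch (a * q / \<rho>) q r * qpoch (a * q / \<sigma>) q r) /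
      (qpoch q q (n - r) * qpoch (a * q) q (n + r))" (is "?L / D = ?R") if r: "r \<le> n" for r
  proof -
    define m where "m = n - r"
    have nr: "n = r + m"
      using r by (simp add: m_def)
    define A B where "A = \<rho> * q ^ r" and "B = \<sigma> * q ^ r"
    have shifts: "A * y = a * q / \<sigma> * q ^ r" "B * y = a * q / \<rho> * q ^ r"
      using nz by (simp_all add: A_def B_def y_def)
    have nz': "qpoch (a * q / \<rho>) q r \<noteq> 0" "qpoch (a * q / \<sigma>) q r \<noteq> 0" "qpoch (a * q) q (n + r) \<noteq> 0"
      "D \<noteq> 0"
      using nz qpoch_nonzero_mono n r unfolding D_def by (auto intro: qpoch_nonzero_mono)
    have summand: "w (r + i) / (qpoch q q (r + i - r) * qpoch (a * q) q (r + i + r)) =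
        qpoch \<rho> q r * qpoch \<sigma> q r * y ^ r / qpoch (a * q) q (n + r) * saal_term A B y q m i"
      if i: "i \<le> m" for i
    proof -
      have eq: "n + r = (r + i + r) + (m - i)" "n - (r + i) = m - i"
        using i by (simp_all add: nr)
      have ABy: "A * B * y * q ^ i = a * q * q ^ (r + i + r)"
        using nz by (simp add: A_def B_def y_def power_add)
      have split: "qpoch (a * q) q (n + r) = qpoch (a * q) q (r + i + r) * qpoch (A * B * y * q ^ i) q (m - i)"
        unfolding ABy eq(1) by (rule qpoch_add)
      with nz' have "qpoch (A * B * y * q ^ i) q (m - i) \<noteq> 0" "qpoch (a * q) q (r + i + r) \<noteq> 0"
        by auto
      then show ?thesis
        unfolding w_def saal_term_def split eq(2) qpoch_add[of \<rho>] qpoch_add[of \<sigma>] A_def[symmetric] B_def[symmetric]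
        by (simp add: power_add) (simp add: mult_ac)
    qed
    have "?L = (\<Sum>i\<le>m. w (r + i) / (qpoch q q (r + i - r) * qpoch (a * q) q (r + i + r)))"
      by (simp add: sum.atLeastAtMost_shift_0[OF r] m_def atMost_atLeast0)
    also have "\<dots> = qpoch \<rho> q r * qpoch \<sigma> q r * y ^ r / qpoch (a * q) q (n + r) *
        (\<Sum>i\<le>m. saal_term A B y q m i)"
      unfolding sum_distrib_left by (intro sum.cong refl summand) simp
    also have "\<dots> = ?R * D"
      unfolding saal_sum[OF q] shifts D_def unfolding nr qpoch_add[of "a * q / \<rho>"] qpoch_add[of "a * q / \<sigma>"]
      using nz' by (simp add: nr) (simp add: mult_ac)
    finally show ?thesis
      using nz' by simp
  qed
  have "(\<Sum>j\<le>n. w j * \<beta> j) =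
      (\<Sum>j\<in>{..n}. \<Sum>r\<in>{r\<in>{..n}. r \<le> j}. w j * (\<alpha> r / (qpoch q q (j - r) * qpoch (a * q) q (j + r))))"
  proof (intro sum.cong refl)
    fix j assume "j \<in> {..n}"
    then have "{r\<in>{..n}. r \<le> j} = {..j}" "j \<le> N"
      using n by auto
    then show "w j * \<beta> j =
      (\<Sum>r\<in>{r\<in>{..n}. r \<le> j}. w j * (\<alpha> r / (qpoch q q (j - r) * qpoch (a * q) q (j + r))))"
      using pair by (simp add: bailey_pair_def sum_distrib_left)
  qed
  also have "\<dots> =
      (\<Sum>r\<in>{..n}. \<Sum>j\<in>{j\<in>{..n}. r \<le> j}. w j * (\<alpha> r / (qpoch q q (j - r) * qpoch (a * q) q (j + r))))"
    by (rule sum.swap_restrict) auto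
  also have "\<dots> = (\<Sum>r\<le>n. \<alpha> r * (\<Sum>j\<in>{r..n}. w j / (qpoch q q (j - r) * qpoch (a * q) q (j + r))))"
    unfolding sum_distrib_left by (intro sum.cong refl) (auto simp: mult_ac)
  finally have "(\<Sum>j\<le>n. w j * \<beta> j) / D =
      (\<Sum>r\<le>n. \<alpha> r * ((\<Sum>j\<in>{r..n}. w j / (qpoch q q (j - r) * qpoch (a * q) q (j + r))) / D))"
    by (simp only: sum_divide_distrib[of _ "{..n}"] times_divide_eq_right)
  also have "\<dots> = (\<Sum>r\<le>n. qpoch \<rho> q r * qpoch \<sigma> q r * y ^ r /
      (qpoch (a * q / \<rho>) q r * qpoch (a * q / \<sigma>) q r) * \<alpha> r / (qpoch q q (n - r) * qpoch (a * q) q (n + r)))"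
    by (intro sum.cong refl, subst inner) auto
  finally show "(\<Sum>j\<le>n. qpoch \<rho> q j * qpoch \<sigma> q j * qpoch y q (n - j) * y ^ j / qpoch q q (n - j) * \<beta> j) /
        (qpoch (a * q / \<rho>) q n * qpoch (a * q / \<sigma>) q n) = \<dots>"
    by (simp only: w_def D_def)
qed

section \<open>Watson's transformation\<close>

text \<open>The term of the very-well-poised series with the square roots multiplied out: they
  contribute \<open>(1 - aq\<^bsup>2r\<^esup>)/(1 - a)\<close>, which is rational in \<open>a\<close>, as the limit in \<open>a\<close> requires.\<close>

definition vwp_term where
  "vwp_term n a b c d e q r =
     qpoch a q r * (1 - a * q ^ (2 * r)) / (1 - a) * qpoch (q powi (- int n)) q r *
     (qpoch b q r * qpoch c q r * qpoch d q r * qpoch e q r) /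
     (qpoch q q r * qpoch (a * q * q ^ n) q r *
      (qpoch (a * q / b) q r * qpoch (a * q / c) q r * qpoch (a * q / d) q r * qpoch (a * q / e) q r)) *
     (q ^ (n + 2) * a\<^sup>2 / (b * c * d * e)) ^ r"

text \<open>This is \<open>(aq/(de);q)\<^sub>n / (q;q)\<^sub>n\<close> times
  \<open>4phi3(q\<^sup>-\<^sup>n, aq/(bc), d, e; aq/b, aq/c, deq\<^sup>-\<^sup>n/a; q, q)\<close>, with the last denominator
  parameter absorbed by reversing its factorial.\<close>

definition balanced_sum where
  "balanced_sum n a b c d e q =
     (\<Sum>j\<le>n. qpoch (a * q / (b * c)) q j * qpoch d q j * qpoch e q j *
        qpoch (a * q / (d * e)) q (n - j) * (a * q / (d * e)) ^ j /
        (qpoch q q j * qpoch q q (n - j) * qpoch (a * q / b) q j * qpoch (a * q / c) q j))"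

text \<open>From the unit pair, Bailey's lemma with \<open>b\<close>, \<open>c\<close> produces a pair whose \<open>\<beta>\<close> is a single
  product, since only the index \<open>0\<close> contributes. Bailey's lemma with \<open>d\<close>, \<open>e\<close> then produces a
  pair whose defining relation at \<open>n\<close> is the transformation.\<close>

lemma watson_generic:
  assumes q: "cmod q \<noteq> 1" "q \<noteq> 0" and nz: "b \<noteq> 0" "c \<noteq> 0" "d \<noteq> 0" "e \<noteq> 0"
    and a: "a \<noteq> 1" "qpoch (a * q) q (2 * n) \<noteq> 0"
      "qpoch (a * q / b) q n \<noteq> 0" "qpoch (a * q / c) q n \<noteq> 0"
      "qpoch (a * q / d) q n \<noteq> 0" "qpoch (a * q / e) q n \<noteq> 0"
  shows "qpoch (a * q / d) q n * qpoch (a * q / e) q n * (\<Sum>r\<le>n. vwp_term n a b c d e q r) =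
     qpoch (a * q) q n * qpoch q q n * balanced_sum n a b c d e q"
proof -
  define y z where "y = a * q / (b * c)" and "z = a * q / (d * e)"
  define \<alpha> where "\<alpha> r = qpoch d q r * qpoch e q r * z ^ r / (qpoch (a * q / d) q r * qpoch (a * q / e) q r) *
     (qpoch b q r * qpoch c q r * y ^ r / (qpoch (a * q / b) q r * qpoch (a * q / c) q r) * unit_alpha a q r)" for r
  define D where "D = qpoch (a * q / d) q n * qpoch (a * q / e) q n"
  have "D \<noteq> 0"
    using a by (simp add: D_def)
  have collapse: "(\<Sum>i\<le>j. F i * (if i = 0 then 1 else 0)) = F 0" for F :: "nat \<Rightarrow> complex" and j :: nat
    by (simp add: if_distrib cong: if_cong)
  have "bailey_pair n a q \<alpha>
     (\<lambda>n. (\<Sum>j\<le>n. qpoch d q j * qpoch e q j * qpoch z q (n - j) * z ^ j / qpoch q q (n - j) *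
        (qpoch y q j / qpoch q q j / (qpoch (a * q / b) q j * qpoch (a * q / c) q j))) /
        (qpoch (a * q / d) q n * qpoch (a * q / e) q n))"
    using bailey_lemma[OF q(1) bailey_lemma[OF q(1) bailey_pair_unit[OF q(1) a(1,2)] nz(1,2) a(2-4)]
      nz(3,4) a(2,5,6)]
    unfolding collapse \<alpha>_def y_def z_def by simp
  then have "(\<Sum>j\<le>n. qpoch d q j * qpoch e q j * qpoch z q (n - j) * z ^ j / qpoch q q (n - j) *
        (qpoch y q j / qpoch q q j / (qpoch (a * q / b) q j * qpoch (a * q / c) q j))) / D
      = (\<Sum>r\<le>n. \<alpha> r / (qpoch q q (n - r) * qpoch (a * q) q (n + r)))"
    unfolding bailey_pair_def D_def by blast
  moreover have "balanced_sum n a b c d e q =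
      (\<Sum>j\<le>n. qpoch d q j * qpoch e q j * qpoch z q (n - j) * z ^ j / qpoch q q (n - j) *
        (qpoch y q j / qpoch q q j / (qpoch (a * q / b) q j * qpoch (a * q / c) q j)))"
    unfolding balanced_sum_def y_def z_def by (intro sum.cong refl) (simp add: mult_ac)
  ultimately have "balanced_sum n a b c d e q =
      D * (\<Sum>r\<le>n. \<alpha> r / (qpoch q q (n - r) * qpoch (a * q) q (n + r)))"
    using \<open>D \<noteq> 0\<close> by (simp add: field_simps)
  moreover have "vwp_term n a b c d e q r =
      qpoch (a * q) q n * qpoch q q n * (\<alpha> r / (qpoch q q (n - r) * qpoch (a * q) q (n + r)))"
    if r: "r \<le> n" for r
  proof -
    have nz1: "qpoch q q (n - r) \<noteq> 0" "qpoch q q r \<noteq> 0" "q ^ (n * r) \<noteq> 0"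
      using qpoch_q_nonzero[OF q(1)] q(2) by auto
    have nz2: "qpoch (a * q) q (n + r) \<noteq> 0"
      using a(2) by (rule qpoch_nonzero_mono) (use r in simp)
    then have nz3: "qpoch (a * q) q n \<noteq> 0" "qpoch (a * q * q ^ n) q r \<noteq> 0"
      by (simp_all add: qpoch_add)
    have z: "(q ^ (n + 2) * a\<^sup>2 / (b * c * d * e)) ^ r = q ^ (n * r) * (y ^ r * z ^ r)"
      by (simp add: y_def z_def power_mult power_mult_distrib[symmetric] power_add power2_eq_square mult_ac)
    have u: "unit_alpha a q r * (qpoch q q n / qpoch q q (n - r)) =
       qpoch a q r * (1 - a * q ^ (2 * r)) / (1 - a) / qpoch q q r *
        (qpoch (q powi (- int n)) q r * q ^ (n * r))"
    proof -
      have *: "(- 1) ^ r * q ^ (r choose 2) * qpoch q q n / qpoch q q (n - r) =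
          qpoch (q powi (- int n)) q r * q ^ (n * r)"
        using qpoch_q_power_minus[OF q(2) r] nz1 by (simp add: field_simps)
      show ?thesis
        unfolding *[symmetric] unit_alpha_def by simp
    qed
    have "qpoch (a * q) q n * qpoch q q n * (\<alpha> r / (qpoch q q (n - r) * qpoch (a * q) q (n + r))) =
       qpoch d q r * qpoch e q r * z ^ r / (qpoch (a * q / d) q r * qpoch (a * q / e) q r) *
       (qpoch b q r * qpoch c q r * y ^ r / (qpoch (a * q / b) q r * qpoch (a * q / c) q r)) *
       (unit_alpha a q r * (qpoch q q n / qpoch q q (n - r))) / qpoch (a * q * q ^ n) q r"
      using nz3 by (simp add: \<alpha>_def qpoch_add) (simp add: mult_ac)
    also have "\<dots> = vwp_term n a b c d e q r"
      unfolding u vwp_term_def z by (simp add: mult_ac)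
    finally show ?thesis
      by simp
  qed
  then have "(\<Sum>r\<le>n. vwp_term n a b c d e q r) = qpoch (a * q) q n * qpoch q q n *
      (\<Sum>r\<le>n. \<alpha> r / (qpoch q q (n - r) * qpoch (a * q) q (n + r)))"
    by (simp add: sum_distrib_left)
  ultimately show ?thesis
    by (simp add: D_def)
qed

lemma tendsto_qpoch [tendsto_intros]:
  "(g \<longlongrightarrow> x) F \<Longrightarrow> ((\<lambda>t. qpoch (g t) q n) \<longlongrightarrow> qpoch x q n) F"
  unfolding qpoch_def by (intro tendsto_intros)

lemma eventually_qpoch_nonzero:
  assumes "q \<noteq> 0" "u \<noteq> 0"
  shows "\<forall>\<^sub>F a in at a0. qpoch (a * q / u) q m \<noteq> 0"
proof -
  have "\<forall>\<^sub>F a in at a0. \<forall>j\<in>{..<m}. a \<noteq> u / (q * q ^ j)"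
    by (intro eventually_ball_finite ballI eventually_neq_at_within) simp
  then show ?thesis
    by eventually_elim (use assms in \<open>auto simp: qpoch_def field_simps\<close>)
qed

text \<open>The two denominators \<open>(aq;q)\<^bsub>n+r\<^esub>\<close> and \<open>(aq;q)\<^sub>n\<close> of the generic argument combine to
  \<open>(aq\<^bsup>n+1\<^esup>;q)\<^sub>r\<close> in the series, so the zeros of \<open>(aq;q)\<^sub>n\<close> are not singularities of either
  side. They are isolated, and the identity extends to them by continuity in \<open>a\<close> with
  \<open>b\<close>, \<open>c\<close>, \<open>d\<close>, \<open>e\<close> kept fixed.\<close>

lemma watson_vwp:
  assumes q: "cmod q \<noteq> 1" "q \<noteq> 0" and nz: "b \<noteq> 0" "c \<noteq> 0" "d \<noteq> 0" "e \<noteq> 0"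
    and a: "a \<noteq> 1" "qpoch (a * q * q ^ n) q n \<noteq> 0"
      "qpoch (a * q / b) q n \<noteq> 0" "qpoch (a * q / c) q n \<noteq> 0"
      "qpoch (a * q / d) q n \<noteq> 0" "qpoch (a * q / e) q n \<noteq> 0"
  shows "qpoch (a * q / d) q n * qpoch (a * q / e) q n * (\<Sum>r\<le>n. vwp_term n a b c d e q r) =
     qpoch (a * q) q n * qpoch q q n * balanced_sum n a b c d e q"
proof -
  define F where "F t = qpoch (t * q / d) q n * qpoch (t * q / e) q n * (\<Sum>r\<le>n. vwp_term n t b c d e q r)" for t
  define G where "G t = qpoch (t * q) q n * qpoch q q n * balanced_sum n t b c d e q" for t
  have "(F \<longlongrightarrow> F a) (at a)"
    unfolding F_def vwp_term_def
    by (intro tendsto_intros) (use q nz a qpoch_q_nonzero in \<open>auto dest: qpoch_nonzero_mono\<close>)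
  moreover have "(G \<longlongrightarrow> G a) (at a)"
    unfolding G_def balanced_sum_def
    by (intro tendsto_intros) (use q nz a qpoch_q_nonzero in \<open>auto dest: qpoch_nonzero_mono\<close>)
  moreover have "\<forall>\<^sub>F t in at a. F t = G t"
  proof -
    \<comment> \<open>The division by \<open>1\<close> gives the second conjunct the same shape as the four after it.\<close>
    have "\<forall>\<^sub>F t in at a. t \<noteq> 1 \<and> qpoch (t * q / 1) q (2 * n) \<noteq> 0 \<and>
      qpoch (t * q / b) q n \<noteq> 0 \<and> qpoch (t * q / c) q n \<noteq> 0 \<and>
      qpoch (t * q / d) q n \<noteq> 0 \<and> qpoch (t * q / e) q n \<noteq> 0"
      by (intro eventually_conj eventually_qpoch_nonzero eventually_neq_at_within q nz) simp
    then show ?thesis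
      by eventually_elim (unfold F_def G_def, intro watson_generic, use q nz in auto)
  qed
  ultimately have "(F \<longlongrightarrow> G a) (at a)"
    using tendsto_cong by blast
  then have "F a = G a"
    using \<open>(F \<longlongrightarrow> F a) (at a)\<close> by (intro tendsto_unique[of "at a"]) auto
  then show ?thesis
    by (simp add: F_def G_def)
qed

lemma qpoch_sqrt_quotient:
  assumes "s\<^sup>2 = a"
  shows "(1 - a) * (qpoch (q * s) q k * qpoch (- q * s) q k) =
           (1 - a * q ^ (2 * k)) * (qpoch s q k * qpoch (- s) q k)"
proof (induction k)
  case (Suc k)
  have *: "(1 - s * q ^ j) * (1 - (- s) * q ^ j) = 1 - a * q ^ (2 * j)" for j
    unfolding assms[symmetric] by (simp add: algebra_simps power_mult power2_eq_square flip: power_mult_distrib)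
  have "(1 - a) * (qpoch (q * s) q (Suc k) * qpoch (- q * s) q (Suc k)) =
     (1 - a) * (qpoch (q * s) q k * qpoch (- q * s) q k) * ((1 - s * q ^ Suc k) * (1 - (- s) * q ^ Suc k))"
    by (simp add: qpoch_Suc mult_ac)
  also have "\<dots> = (1 - a * q ^ (2 * Suc k)) *
      (qpoch s q k * qpoch (- s) q k * ((1 - s * q ^ k) * (1 - (- s) * q ^ k)))"
    unfolding Suc * by simp
  also have "\<dots> = (1 - a * q ^ (2 * Suc k)) * (qpoch s q (Suc k) * qpoch (- s) q (Suc k))"
    by (simp add: qpoch_Suc mult_ac)
  finally show ?case .
qed simp

lemma W87_wf_nonzero:
  assumes "W87_wf n a b c d e q" "q \<noteq> 0"
  shows "\<forall>x\<in>set (W87_den n a b c d e q). qpoch x q n \<noteq> 0"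
  using assms by (metis W87_wf_def qpoch_eq_0_iff)

text \<open>For \<open>n > 0\<close> the condition on \<open>\<plusminus>\<surd>a\<close> as denominator parameters excludes \<open>a = 1\<close>, where
  the rational form of the term would divide by zero. For \<open>n = 0\<close> it excludes nothing, but
  then both sides are \<open>1\<close>.\<close>

lemma watson_transformation:
  assumes q: "cmod q \<noteq> 1" "q \<noteq> 0" and nz: "b \<noteq> 0" "c \<noteq> 0" "d \<noteq> 0" "e \<noteq> 0"
    and wf: "W87_wf n a b c d e q"
  shows "qpoch (a * q / d) q n * qpoch (a * q / e) q n *
       W87 n a b c d e q (q ^ (n + 2) * a\<^sup>2 / (b * c * d * e)) =
     qpoch (a * q) q n * qpoch q q n * balanced_sum n a b c d e q"
proof (cases "n = 0")
  case True
  then show ?thesis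
    by (simp add: W87_def qpochs_def W87_num_def W87_den_def balanced_sum_def)
next
  case False
  define s where "s = csqrt a"
  have s: "s\<^sup>2 = a"
    by (simp add: s_def)
  have den: "qpoch s q n \<noteq> 0" "qpoch (- s) q n \<noteq> 0" "qpoch (a * q * q ^ n) q n \<noteq> 0"
    "qpoch (a * q / b) q n \<noteq> 0" "qpoch (a * q / c) q n \<noteq> 0"
    "qpoch (a * q / d) q n \<noteq> 0" "qpoch (a * q / e) q n \<noteq> 0"
    using W87_wf_nonzero[OF wf q(2)] by (auto simp: W87_den_def s_def mult_ac)
  have "qpoch s q 1 \<noteq> 0" "qpoch (- s) q 1 \<noteq> 0"
    using False den qpoch_nonzero_mono[of _ q n 1] by auto
  then have a1: "a \<noteq> 1"
    unfolding s[symmetric] by (auto simp: qpoch_Suc power2_eq_1_iff add_eq_0_iff)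
  have "W87 n a b c d e q (q ^ (n + 2) * a\<^sup>2 / (b * c * d * e)) = (\<Sum>r\<le>n. vwp_term n a b c d e q r)"
    unfolding W87_def
  proof (intro sum.cong refl)
    fix r assume "r \<in> {..n}"
    then have "qpoch s q r \<noteq> 0" "qpoch (- s) q r \<noteq> 0"
      using den qpoch_nonzero_mono[of _ q n r] by auto
    then have sq: "(1 - a * q ^ (2 * r)) / (1 - a) =
        qpoch (q * s) q r * qpoch (- q * s) q r / (qpoch s q r * qpoch (- s) q r)"
      using qpoch_sqrt_quotient[OF s, of q r] a1 by (simp add: field_simps)
    have "vwp_term n a b c d e q r =
     qpoch a q r * ((1 - a * q ^ (2 * r)) / (1 - a)) * qpoch (q powi (- int n)) q r *
     (qpoch b q r * qpoch c q r * qpoch d q r * qpoch e q r) /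
     (qpoch q q r * qpoch (a * q * q ^ n) q r *
      (qpoch (a * q / b) q r * qpoch (a * q / c) q r * qpoch (a * q / d) q r * qpoch (a * q / e) q r)) *
     (q ^ (n + 2) * a\<^sup>2 / (b * c * d * e)) ^ r"
      by (simp add: vwp_term_def)
    then show "qpochs (W87_num n a b c d e q) q r / qpochs (W87_den n a b c d e q) q r *
        (q ^ (n + 2) * a\<^sup>2 / (b * c * d * e)) ^ r = vwp_term n a b c d e q r"
      unfolding sq by (simp add: W87_num_def W87_den_def qpochs_def s_def mult_ac)
  qed
  then show ?thesis
    using watson_vwp[OF q nz a1 den(3-7)] by simp
qed

section \<open>Exchanging two parameters\<close>

text \<open>The balanced sum of the transformation at \<open>a = qb\<^sup>2/(def)\<close> with parameters
  \<open>qb/(de)\<close>, \<open>qb/(df)\<close>, \<open>qb/(ef)\<close>, \<open>c\<close>, in which \<open>aq/(bc)\<close> has become \<open>d\<close>.\<close>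

definition sym_sum where
  "sym_sum n b c d e f q =
     (\<Sum>j\<le>n. qpoch c q j * qpoch d q j * qpoch (q * b / (e * f)) q j *
        qpoch (q * b / (c * d)) q (n - j) * (q * b / (c * d)) ^ j /
        (qpoch q q j * qpoch q q (n - j) * qpoch (q * b / e) q j * qpoch (q * b / f) q j))"

lemma sym_sum_commute: "sym_sum n b c d e f q = sym_sum n b d c e f q"
  by (simp add: sym_sum_def mult_ac)

lemma W87_eq_sym_sum:
  assumes nz: "b \<noteq> 0" "c \<noteq> 0" "d \<noteq> 0" "e \<noteq> 0" "f \<noteq> 0" and q: "q \<noteq> 0" "cmod q \<noteq> 1"
    and wf: "W87_wf n (q*b^2/(d*e*f)) (q*b/(d*e)) (q*b/(d*f)) (q*b/(e*f)) c q"
  shows "qpoch (q*b/d) q n * qpoch (q^2*b^2/(c*d*e*f)) q n *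
      W87 n (q*b^2/(d*e*f)) (q*b/(d*e)) (q*b/(d*f)) (q*b/(e*f)) c q (q^(n+1)*b/c) =
      qpoch (q^2*b^2/(d*e*f)) q n * qpoch q q n * sym_sum n b c d e f q"
    and "qpoch (q^2*b^2/(c*d*e*f)) q n \<noteq> 0"
proof -
  define a where "a = q*b^2/(d*e*f)"
  have quot: "a * q / (q*b/(d*e)) = q * b / f" "a * q / (q*b/(d*f)) = q * b / e"
    "a * q / (q*b/(e*f)) = q * b / d" "a * q / c = q^2*b^2/(c*d*e*f)" "a * q = q^2*b^2/(d*e*f)"
    "a * q / ((q*b/(d*e)) * (q*b/(d*f))) = d" "a * q / ((q*b/(e*f)) * c) = q * b / (c * d)"
    "q ^ (n + 2) * a\<^sup>2 / ((q*b/(d*e)) * (q*b/(d*f)) * (q*b/(e*f)) * c) = q^(n+1)*b/c"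
    using nz q by (simp_all add: a_def field_simps power2_eq_square)
  have sum: "balanced_sum n a (q*b/(d*e)) (q*b/(d*f)) (q*b/(e*f)) c q = sym_sum n b c d e f q"
    unfolding balanced_sum_def sym_sum_def quot(1,2,6,7) by (simp add: mult_ac)
  have "W87_wf n a (q*b/(d*e)) (q*b/(d*f)) (q*b/(e*f)) c q"
    using wf by (simp only: a_def)
  from watson_transformation[OF q(2,1) _ _ _ _ this] nz q
  show "qpoch (q*b/d) q n * qpoch (q^2*b^2/(c*d*e*f)) q n *
      W87 n (q*b^2/(d*e*f)) (q*b/(d*e)) (q*b/(d*f)) (q*b/(e*f)) c q (q^(n+1)*b/c) =
      qpoch (q^2*b^2/(d*e*f)) q n * qpoch q q n * sym_sum n b c d e f q"
    unfolding sum quot(3,4,8) unfolding quot(5) by (simp add: a_def)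
  have "qpoch (q * a / c) q n \<noteq> 0"
    using W87_wf_nonzero[OF wf q(1)] by (simp add: W87_den_def a_def)
  then show "qpoch (q^2*b^2/(c*d*e*f)) q n \<noteq> 0"
    unfolding quot(4)[symmetric] by (simp add: mult.commute)
qed

text \<open>Both series are multiples of the same symmetric sum, and \<open>(q\<^sup>2b\<^sup>2/(cdef);q)\<^sub>n\<close> is common to
  the two prefactors. The symmetric sum may vanish, so the two relations are combined by
  cross-multiplication and not by division.\<close>

lemma W87_exchange:
  assumes nz: "b \<noteq> 0" "c \<noteq> 0" "d \<noteq> 0" "e \<noteq> 0" "f \<noteq> 0" and q: "q \<noteq> 0" "cmod q \<noteq> 1"
    and wf1: "W87_wf n (q*b^2/(d*e*f)) (q*b/(d*e)) (q*b/(d*f)) (q*b/(e*f)) c q"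
    and wf2: "W87_wf n (q*b^2/(c*e*f)) (q*b/(c*e)) (q*b/(c*f)) (q*b/(e*f)) d q"
    and pre: "qpochs [q*b/d, q^2*b^2/(c*e*f)] q n \<noteq> 0"
  shows "W87 n (q*b^2/(d*e*f)) (q*b/(d*e)) (q*b/(d*f)) (q*b/(e*f)) c q (q^(n+1)*b/c) =
       qpochs [q*b/c, q^2*b^2/(d*e*f)] q n / qpochs [q*b/d, q^2*b^2/(c*e*f)] q n *
       W87 n (q*b^2/(c*e*f)) (q*b/(c*e)) (q*b/(c*f)) (q*b/(e*f)) d q (q^(n+1)*b/d)"
    (is "?W1 = _ * ?W2")
proof -
  define Z where "Z = qpoch (q^2*b^2/(c*d*e*f)) q n"
  define S where "S = qpoch q q n * sym_sum n b c d e f q"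
  have "Z \<noteq> 0"
    using W87_eq_sym_sum(2)[OF nz q wf1] by (simp add: Z_def)
  have W1: "qpoch (q*b/d) q n * Z * ?W1 = qpoch (q^2*b^2/(d*e*f)) q n * S"
    using W87_eq_sym_sum(1)[OF nz q wf1] by (simp add: Z_def S_def)
  have W2: "qpoch (q*b/c) q n * Z * ?W2 = qpoch (q^2*b^2/(c*e*f)) q n * S"
    using W87_eq_sym_sum(1)[OF nz(1,3,2,4,5) q wf2] sym_sum_commute[of n b d c]
    by (simp add: Z_def S_def mult.commute[of d c])
  have nz': "qpoch (q*b/d) q n \<noteq> 0" "qpoch (q^2*b^2/(c*e*f)) q n \<noteq> 0"
    using pre by (auto simp: qpochs_def)
  have ring: "?thesis" if "P * Z * ?W1 = R * S" "Q * Z * ?W2 = T * S" "P \<noteq> 0" "T \<noteq> 0"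
    "qpochs [q*b/c, q^2*b^2/(d*e*f)] q n = Q * R" "qpochs [q*b/d, q^2*b^2/(c*e*f)] q n = P * T"
    for P Q R T
  proof -
    have "Z * (P * T * ?W1) = Z * (Q * R * ?W2)"
      using that(1,2) by algebra
    then have "P * T * ?W1 = Q * R * ?W2"
      using \<open>Z \<noteq> 0\<close> by simp
    then show ?thesis
      unfolding that(5,6) using that(3,4) by (simp add: field_simps)
  qed
  show ?thesis
    by (rule ring[OF W1 W2 nz']) (simp_all add: qpochs_def)
qed

lemma W87_permute:
  "W87 n a u v w c q z = W87 n a v u w c q z"
  "W87 n a u v w c q z = W87 n a u w v c q z"
  "W87_wf n a u v w c q = W87_wf n a v u w c q"
  "W87_wf n a u v w c q = W87_wf n a u w v c q"
  by (auto simp: W87_def W87_wf_def W87_num_def W87_den_def qpochs_def mult_ac)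

theorem corollary3p6:
  fixes n :: nat and b c d e f q :: complex
  assumes "b \<noteq> 0" "c \<noteq> 0" "d \<noteq> 0" "e \<noteq> 0" "f \<noteq> 0" "q \<noteq> 0"
    and "cmod q \<noteq> 1"
    and "W87_wf n (q*b^2/(d*e*f)) (q*b/(d*e)) (q*b/(d*f)) (q*b/(e*f)) c q"
    and "W87_wf n (q*b^2/(c*e*f)) (q*b/(c*e)) (q*b/(c*f)) (q*b/(e*f)) d q"
    and "W87_wf n (q*b^2/(c*d*f)) (q*b/(c*d)) (q*b/(c*f)) (q*b/(d*f)) e q"
    and "W87_wf n (q*b^2/(c*d*e)) (q*b/(c*d)) (q*b/(c*e)) (q*b/(d*e)) f q"
    and "qpochs [q*b/d, q^2*b^2/(c*e*f)] q n \<noteq> 0"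
    and "qpochs [q*b/e, q^2*b^2/(c*d*f)] q n \<noteq> 0"
    and "qpochs [q*b/f, q^2*b^2/(c*d*e)] q n \<noteq> 0"
  shows
    "W87 n (q*b^2/(d*e*f)) (q*b/(d*e)) (q*b/(d*f)) (q*b/(e*f)) c q (q^(n+1)*b/c) =
       qpochs [q*b/c, q^2*b^2/(d*e*f)] q n / qpochs [q*b/d, q^2*b^2/(c*e*f)] q n *
       W87 n (q*b^2/(c*e*f)) (q*b/(c*e)) (q*b/(c*f)) (q*b/(e*f)) d q (q^(n+1)*b/d)
     \<and>
     W87 n (q*b^2/(d*e*f)) (q*b/(d*e)) (q*b/(d*f)) (q*b/(e*f)) c q (q^(n+1)*b/c) =
       qpochs [q*b/c, q^2*b^2/(d*e*f)] q n / qpochs [q*b/e, q^2*b^2/(c*d*f)] q n *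
       W87 n (q*b^2/(c*d*f)) (q*b/(c*d)) (q*b/(c*f)) (q*b/(d*f)) e q (q^(n+1)*b/e)
     \<and>
     W87 n (q*b^2/(d*e*f)) (q*b/(d*e)) (q*b/(d*f)) (q*b/(e*f)) c q (q^(n+1)*b/c) =
       qpochs [q*b/c, q^2*b^2/(d*e*f)] q n / qpochs [q*b/f, q^2*b^2/(c*d*e)] q n *
       W87 n (q*b^2/(c*d*e)) (q*b/(c*d)) (q*b/(c*e)) (q*b/(d*e)) f q (q^(n+1)*b/f)"
proof (intro conjI)
  show "W87 n (q*b^2/(d*e*f)) (q*b/(d*e)) (q*b/(d*f)) (q*b/(e*f)) c q (q^(n+1)*b/c) =
       qpochs [q*b/c, q^2*b^2/(d*e*f)] q n / qpochs [q*b/d, q^2*b^2/(c*e*f)] q n *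
       W87 n (q*b^2/(c*e*f)) (q*b/(c*e)) (q*b/(c*f)) (q*b/(e*f)) d q (q^(n+1)*b/d)"
    by (rule W87_exchange) (use assms in auto)
next
  have reorder: "q*b^2/(e*d*f) = q*b^2/(d*e*f)" "q*b/(e*d) = q*b/(d*e)"
    "q^2*b^2/(e*d*f) = q^2*b^2/(d*e*f)"
    by (simp_all add: mult_ac)
  have "W87_wf n (q*b^2/(e*d*f)) (q*b/(e*d)) (q*b/(e*f)) (q*b/(d*f)) c q"
    unfolding reorder W87_permute(4)[of n _ _ "q*b/(e*f)"] by (fact assms(8))
  from W87_exchange[OF assms(1,2,4,3,5,6,7) this assms(10,13)]
  show "W87 n (q*b^2/(d*e*f)) (q*b/(d*e)) (q*b/(d*f)) (q*b/(e*f)) c q (q^(n+1)*b/c) =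
       qpochs [q*b/c, q^2*b^2/(d*e*f)] q n / qpochs [q*b/e, q^2*b^2/(c*d*f)] q n *
       W87 n (q*b^2/(c*d*f)) (q*b/(c*d)) (q*b/(c*f)) (q*b/(d*f)) e q (q^(n+1)*b/e)"
    unfolding reorder W87_permute(2)[of n _ "q*b/(d*e)" "q*b/(d*f)"] .
next
  have reorder: "q*b^2/(f*d*e) = q*b^2/(d*e*f)" "q*b/(f*d) = q*b/(d*f)" "q*b/(f*e) = q*b/(e*f)"
    "q^2*b^2/(f*d*e) = q^2*b^2/(d*e*f)"
    by (simp_all add: mult_ac)
  have cycle: "W87 n a u v w c q z = W87 n a v w u c q z"
    "W87_wf n a u v w c q = W87_wf n a v w u c q" for a u v w z
    using W87_permute by metis+
  have "W87_wf n (q*b^2/(f*d*e)) (q*b/(f*d)) (q*b/(f*e)) (q*b/(d*e)) c q"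
    using assms(8) unfolding reorder cycle(2)[of _ "q*b/(d*e)" "q*b/(d*f)"] .
  from W87_exchange[OF assms(1,2,5,3,4,6,7) this assms(11,14)]
  show "W87 n (q*b^2/(d*e*f)) (q*b/(d*e)) (q*b/(d*f)) (q*b/(e*f)) c q (q^(n+1)*b/c) =
       qpochs [q*b/c, q^2*b^2/(d*e*f)] q n / qpochs [q*b/f, q^2*b^2/(c*d*e)] q n *
       W87 n (q*b^2/(c*d*e)) (q*b/(c*d)) (q*b/(c*e)) (q*b/(d*e)) f q (q^(n+1)*b/f)"
    unfolding reorder cycle(1)[of _ "q*b/(d*e)" "q*b/(d*f)"] .
qed

end
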